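(* Consider a PEPA model without passive rates, and its derived ODEs $\frac{\mathrm{d}\mathbf{x}}{\mathrm{d}t}=F(\mathbf{x})=\sum_{l}l\,f(\mathbf{x},l)$ (sum over all labelled activities $l$). Then for any initial value $\mathbf{x}(0)\in\mathbb{R}^d$ these ODEs have a unique solution on the time interval $[0,\infty)$.
   Context: A PEPA model (all activity rates positive reals; no passive/unspecified rates) has component types $C_1,\dots,C_n$; type $C_i$ has distinct local derivatives $C_{i_1},\dots,C_{i_{d_i}}$, and $d=\sum_i d_i$. A state is a vector $\mathbf{x}\in\mathbb{R}^d$ indexed by local derivatives, $\mathbf{x}[U]$ being the number (in the fluid setting, the amount) of components in local derivative $U$. The model has transitions $P\xrightarrow{(\alpha,r_\alpha^{P\to Q})}Q$ between local derivatives of the same type; an action type is individual if only one component type enables it and shared (synchronised) otherwise. For $P$ enabling $\alpha$ put $r_\alpha(P)=\sum_Q r_\alpha^{P\to Q}$ (over all $Q$ with $P\xrightarrow{\alpha}Q$). Labelled activities: for individual $\alpha$, one labelled activity $\alpha^{P\to Q}$ per transition $P\xrightarrow{\alpha}Q$, with pre set $\{P\}$, post set $\{Q\}$ and rate function $f(\mathbf{x},\alpha^{P\to Q})=\mathbf{x}[P]\,r_\alpha^{P\to Q}$; for shared $\alpha$ with enabling local derivatives $P_1,\dots,P_k$ (in different component types), one labelled activity $\alpha^w$ for each choice $w=(P_1\to Q_1,\dots,P_k\to Q_k)$ of transitions $P_i\xrightarrow{\alpha}Q_i$, with pre set $\{P_1,\dots,P_k\}$, post set $\{Q_1,\dots,Q_k\}$,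 and rate function $f(\mathbf{x},\alpha^w)=\Big(\prod_{i=1}^k \frac{r_\alpha^{P_i\to Q_i}}{r_\alpha(P_i)}\Big)\min_{1\le i\le k}\{\mathbf{x}[P_i]\,r_\alpha(P_i)\}$. Each labelled activity $l$ is identified with its transition vector $l\in\{-1,0,1\}^d$: $l[U]=1$ if $U$ is in its post set, $-1$ if in its pre set, $0$ otherwise. The derived ODEs are $\frac{\mathrm{d}\mathbf{x}}{\mathrm{d}t}=\sum_l l\,f(\mathbf{x},l)$. *)

theory Defs
  imports "HOL-Analysis.Analysis"
begin

text \<open>
  The type \<open>'d\<close> is the set of all local derivatives of all component types (so the state space is
  \<open>real ^ 'd\<close>), \<open>'c\<close> the set of component types and \<open>'a\<close> the set of action types.
  The value \<open>rate M \<alpha> P Q\<close> is meaningful only if \<open>(P, \<alpha>, Q)\<close> is a transition.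
\<close>

record ('d, 'c, 'a) pepa =
  component_type :: "'d \<Rightarrow> 'c"
  transitions :: "('d \<times> 'a \<times> 'd) set"
  rate :: "'a \<Rightarrow> 'd \<Rightarrow> 'd \<Rightarrow> real"

definition enabling :: "('d, 'c, 'a) pepa \<Rightarrow> 'a \<Rightarrow> 'd set" where
  "enabling M \<alpha> = {P. \<exists>Q. (P, \<alpha>, Q) \<in> transitions M}"

definition individual :: "('d, 'c, 'a) pepa \<Rightarrow> 'a \<Rightarrow> bool" where
  "individual M \<alpha> \<longleftrightarrow> card (component_type M ` enabling M \<alpha>) = 1"

text \<open>An element of \<open>'a\<close> that no local derivative enables is not an action type of the model:
  it is neither individual nor shared.\<close>

definition shared :: "('d, 'c, 'a) pepa \<Rightarrow> 'a \<Rightarrow> bool" where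
  "shared M \<alpha> \<longleftrightarrow> enabling M \<alpha> \<noteq> {} \<and> \<not> individual M \<alpha>"

definition pepa_model :: "('d::finite, 'c, 'a) pepa \<Rightarrow> bool" where
  "pepa_model M \<longleftrightarrow>
     surj (component_type M) \<and>
     finite (transitions M) \<and>
     (\<forall>P \<alpha> Q. (P, \<alpha>, Q) \<in> transitions M \<longrightarrow>
        component_type M P = component_type M Q \<and> rate M \<alpha> P Q > 0) \<and>
     (\<forall>\<alpha>. shared M \<alpha> \<longrightarrow> inj_on (component_type M) (enabling M \<alpha>))"

definition apparent_rate :: "('d::finite, 'c, 'a) pepa \<Rightarrow> 'a \<Rightarrow> 'd \<Rightarrow> real" where
  "apparent_rate M \<alpha> P = (\<Sum>Q | (P, \<alpha>, Q) \<in> transitions M. rate M \<alpha> P Q)"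

text \<open>
  \<open>Individual \<alpha> P Q\<close> stands for the labelled activity $\alpha^{P\to Q}$, and \<open>Shared \<alpha> w\<close> for
  $\alpha^w$, where the choice $w=(P_1\to Q_1,\dots,P_k\to Q_k)$ is the finite map sending each
  $P_i$ to $Q_i$.
\<close>

datatype ('d, 'a) activity =
    Individual 'a 'd 'd
  | Shared 'a "'d \<rightharpoonup> 'd"

definition activities :: "('d, 'c, 'a) pepa \<Rightarrow> ('d, 'a) activity set" where
  "activities M =
     {Individual \<alpha> P Q | \<alpha> P Q. individual M \<alpha> \<and> (P, \<alpha>, Q) \<in> transitions M} \<union>
     {Shared \<alpha> w | \<alpha> w. shared M \<alpha> \<and> dom w = enabling M \<alpha> \<and>
        (\<forall>P Q. w P = Some Q \<longrightarrow> (P, \<alpha>, Q) \<in> transitions M)}"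

fun pre_set :: "('d, 'a) activity \<Rightarrow> 'd set" where
  "pre_set (Individual \<alpha> P Q) = {P}"
| "pre_set (Shared \<alpha> w) = dom w"

fun post_set :: "('d, 'a) activity \<Rightarrow> 'd set" where
  "post_set (Individual \<alpha> P Q) = {Q}"
| "post_set (Shared \<alpha> w) = ran w"

text \<open>
  A local derivative lies in both the pre set and the post set exactly when it takes part through a
  self-loop; its amount is then unchanged, so its entry is \<open>0\<close>.
\<close>

definition transition_vector :: "('d::finite, 'a) activity \<Rightarrow> real ^ 'd" where
  "transition_vector l = (\<chi> U.
     if U \<in> post_set l \<and> U \<notin> pre_set l then 1
     else if U \<in> pre_set l \<and> U \<notin> post_set l then - 1
     else 0)"

fun rate_fun :: "('d::finite, 'c, 'a) pepa \<Rightarrow> real ^ 'd \<Rightarrow> ('d, 'a) activity \<Rightarrow> real" where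
  "rate_fun M x (Individual \<alpha> P Q) = x $ P * rate M \<alpha> P Q"
| "rate_fun M x (Shared \<alpha> w) =
     (\<Prod>P\<in>dom w. rate M \<alpha> P (the (w P)) / apparent_rate M \<alpha> P) *
     Min ((\<lambda>P. x $ P * apparent_rate M \<alpha> P) ` dom w)"

definition derived_field :: "('d::finite, 'c, 'a) pepa \<Rightarrow> real ^ 'd \<Rightarrow> real ^ 'd" where
  "derived_field M x = (\<Sum>l\<in>activities M. rate_fun M x l *\<^sub>R transition_vector l)"

text \<open>The sum above is a genuine finite sum.\<close>

lemma finite_activities:
  fixes M :: "('d::finite, 'c, 'a) pepa"
  assumes "pepa_model M"
  shows "finite (activities M)"
proof -
  let ?T = "transitions M"
  let ?A = "(\<lambda>(P, \<alpha>, Q). \<alpha>) ` ?T"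
  have fin: "finite ?T" using assms by (simp add: pepa_model_def)
  have "activities M \<subseteq> (\<lambda>(P, \<alpha>, Q). Individual \<alpha> P Q) ` ?T \<union>
      (\<lambda>(\<alpha>, w). Shared \<alpha> w) ` (?A \<times> UNIV)"
  proof
    fix l assume "l \<in> activities M"
    then consider
        (ind) \<alpha> P Q where "l = Individual \<alpha> P Q" "(P, \<alpha>, Q) \<in> ?T"
      | (sh) \<alpha> w where "l = Shared \<alpha> w" "enabling M \<alpha> \<noteq> {}"
      unfolding activities_def shared_def by blast
    then show "l \<in> (\<lambda>(P, \<alpha>, Q). Individual \<alpha> P Q) ` ?T \<union>
        (\<lambda>(\<alpha>, w). Shared \<alpha> w) ` (?A \<times> UNIV)"
    proof cases
      case ind
      then show ?thesis by (intro UnI1 image_eqI[where x = "(P, \<alpha>, Q)"]) auto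
    next
      case sh
      then obtain P Q where "(P, \<alpha>, Q) \<in> ?T"
        unfolding enabling_def by blast
      then have "\<alpha> \<in> ?A" by (intro image_eqI[where x = "(P, \<alpha>, Q)"]) auto
      with sh show ?thesis by (intro UnI2 image_eqI[where x = "(\<alpha>, w)"]) auto
    qed
  qed
  moreover have "finite (?A \<times> (UNIV :: ('d \<rightharpoonup> 'd) set))"
    using fin by (intro finite_cartesian_product finite_imageI finite_class.finite_UNIV)
  ultimately show ?thesis
    using fin by (meson finite_UnI finite_imageI finite_subset)
qed

definition solves_derived_odes ::
  "('d::finite, 'c, 'a) pepa \<Rightarrow> real ^ 'd \<Rightarrow> (real \<Rightarrow> real ^ 'd) \<Rightarrow> bool" where
  "solves_derived_odes M x0 x \<longleftrightarrow>
     x 0 = x0 \<and>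
     (\<forall>t\<in>{0..}. (x has_vector_derivative derived_field M (x t)) (at t within {0..}))"

end

(*
  The derived vector field is globally Lipschitz on the whole space: rate functions of individual
  activities are linear, those of shared activities are multiples of a minimum of finitely many
  linear functions. The Picard operator of a vector field with Lipschitz constant L is a
  contraction, on all of [0, infinity) at once, in the weighted norm
  sup_t exp (- (L + 1) t) |x(t) - x0|; this gives a global solution without gluing local ones.
  Two solutions x and y agree because exp (- 2 L t) |y(t) - x(t)|^2 is nonincreasing.
*)
theory Submission
  imports Defs
begin

section \<open>Globally Lipschitz differential equations\<close>

text \<open>Integrating the exponential bound gains a factor \<open>1 / K\<close>, and the weight
  cancels the growth. This serves twice below: to show that Picard iterates stay bounded and that
  the iteration contracts.\<close>

lemma norm_weighted_integral_le:
  fixes u :: "real \<Rightarrow> 'a::banach"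
  assumes cont: "continuous_on {0..t} u" and "K > 0" and "t \<ge> 0"
    and bound: "\<And>s. s \<in> {0..t} \<Longrightarrow> norm (u s) \<le> c * exp (K * s)"
  shows "norm (exp (- (K * t)) *\<^sub>R integral {0..t} u) \<le> c / K"
proof -
  \<comment> \<open>Reading the bound at 0 gives the sign of \<open>c\<close>, which later lets the
    lower-limit term \<open>- c / K\<close> be dropped.\<close>
  have "norm (u 0) \<le> c * exp (K * 0)"
    using \<open>t \<ge> 0\<close> by (intro bound) simp
  then have "c \<ge> 0"
    by (simp add: order_trans[OF norm_ge_zero])
  have "((\<lambda>s. c * exp (K * s)) has_integral c / K * exp (K * t) - c / K * exp (K * 0)) {0..t}"
    using \<open>K > 0\<close> \<open>t \<ge> 0\<close>
    by (intro fundamental_theorem_of_calculus)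
       (auto intro!: derivative_eq_intros simp flip: has_real_derivative_iff_has_vector_derivative)
  then have *: "(\<lambda>s. c * exp (K * s)) integrable_on {0..t}"
    "integral {0..t} (\<lambda>s. c * exp (K * s)) = c / K * exp (K * t) - c / K * exp (K * 0)"
    by (rule has_integral_integrable, rule integral_unique)
  have "norm (integral {0..t} u) \<le> integral {0..t} (\<lambda>s. c * exp (K * s))"
    using cont bound by (intro integral_norm_bound_integral integrable_continuous_real *) auto
  also have "\<dots> \<le> c / K * exp (K * t)"
    unfolding * using \<open>c \<ge> 0\<close> \<open>K > 0\<close> by simp
  finally have "norm (exp (- (K * t)) *\<^sub>R integral {0..t} u) \<le> exp (- (K * t)) * (c / K * exp (K * t))"
    unfolding norm_scaleR by (simp only: abs_exp_cancel mult_left_mono exp_ge_zero)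
  also have "\<dots> = c / K"
    by (simp add: exp_minus field_simps)
  finally show ?thesis .
qed

text \<open>The integral form asks only for continuity, so Banach's theorem applies in the complete
  space of bounded continuous functions. The unknown there is the weighted deviation of
  \<open>x\<close> from \<open>x0\<close>.\<close>

lemma lipschitz_integral_equation_exists:
  fixes F :: "'a::banach \<Rightarrow> 'a"
  assumes lip: "L-lipschitz_on UNIV F"
  obtains x :: "real \<Rightarrow> 'a" where "continuous_on UNIV x"
    "\<And>t. t \<ge> 0 \<Longrightarrow> x t = x0 + integral {0..t} (\<lambda>s. F (x s))"
proof -
  \<comment> \<open>Any \<open>K > L\<close> makes the contraction factor \<open>L / K\<close> less
    than 1; adding 1 also keeps \<open>K\<close> positive when \<open>L = 0\<close>.\<close>
  define K where "K = L + 1"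
  have "L \<ge> 0" using lip by (rule lipschitz_on_nonneg)
  then have "K > 0" by (simp add: K_def)
  have contF: "continuous_on S (\<lambda>s. F (h s))" if "continuous_on S h" for S :: "real set" and h
    using continuous_on_compose2[OF lipschitz_on_continuous_on[OF lip] that] by simp
  \<comment> \<open>\<open>G g\<close> is the Picard operator for \<open>x = x0 + exp (K * _) *\<^sub>R g\<close>, made constant on negative times
    so that it acts on bounded continuous functions on all of \<open>real\<close>.\<close>
  define H where "H g s = F (x0 + exp (K * s) *\<^sub>R apply_bcontfun g s)" for g s
  define G where "G g t = exp (- (K * max 0 t)) *\<^sub>R integral {0..max 0 t} (H g)" for g t
  have contH: "continuous_on S (H g)" for S g
    unfolding H_def by (intro contF continuous_intros continuous_on_apply_bcontfun)
  have "G g \<in> bcontfun" for g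
  proof (rule bcontfun_normI)
    have "continuous (at t within {0..}) (\<lambda>t. integral {0..t} (H g))" if "t \<ge> 0" for t
    proof -
      \<comment> \<open>The library fact concerns compact intervals. Ending at \<open>t + 1\<close>
        keeps \<open>t\<close> off the right end, so the filter at \<open>t\<close> is that of the
        half-line.\<close>
      have "continuous (at t within {0..t + 1}) (\<lambda>t. integral {0..t} (H g))"
        using indefinite_integral_continuous_1[OF integrable_continuous_real[OF contH[of "{0..t + 1}" g]]] that
        by (simp add: continuous_on_eq_continuous_within)
      moreover have "at t within {0..t + 1} = at t within {0..}"
        by (rule at_within_nhd[of _ "{..<t + 1}"]) auto
      ultimately show ?thesis by simp
    qed
    then have "continuous_on {0..} (\<lambda>t. integral {0..t} (H g))"
      by (simp add: continuous_on_eq_continuous_within)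
    then have "continuous_on UNIV (\<lambda>t. integral {0..max 0 t} (H g))"
      by (rule continuous_on_compose2) (auto intro!: continuous_intros)
    then show "continuous_on UNIV (G g)"
      unfolding G_def by (intro continuous_intros)
    \<comment> \<open>\<open>F\<close> grows at most linearly away from \<open>x0\<close>; since
      \<open>exp (K * s)\<close> is at least 1, it absorbs the constant \<open>norm (F x0)\<close>
      as well.\<close>
    show "norm (G g t) \<le> (norm (F x0) + L * norm g) / K" for t
      unfolding G_def
    proof (rule norm_weighted_integral_le[OF contH \<open>K > 0\<close>])
      fix s assume "s \<in> {0..max 0 t}"
      then have e: "exp (K * s) \<ge> 1" using \<open>K > 0\<close> by simp
      have "norm (H g s) \<le> norm (F x0) + norm (H g s - F x0)"
        using norm_triangle_sub by blast
      also have "\<dots> \<le> norm (F x0) + L * norm (exp (K * s) *\<^sub>R apply_bcontfun g s)"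
        using lipschitz_on_normD[OF lip, of "x0 + exp (K * s) *\<^sub>R apply_bcontfun g s" x0]
        by (simp add: H_def)
      also have "\<dots> \<le> norm (F x0) * exp (K * s) + L * (exp (K * s) * norm g)"
        using e \<open>L \<ge> 0\<close> mult_left_mono[OF e norm_ge_zero[of "F x0"]]
        by (intro add_mono mult_left_mono) (auto intro: norm_bounded)
      finally show "norm (H g s) \<le> (norm (F x0) + L * norm g) * exp (K * s)"
        by (simp add: algebra_simps)
    qed simp
  qed
  then have G: "apply_bcontfun (Bcontfun (G g)) = G g" for g
    by (rule Bcontfun_inverse)
  \<comment> \<open>The common \<open>x0\<close> cancels, so the integrands differ by at most
    \<open>L * dist g h * exp (K * s)\<close>, and the weighted integral divides by
    \<open>K\<close>.\<close>
  have "dist (Bcontfun (G g)) (Bcontfun (G h)) \<le> L / K * dist g h" for g h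
  proof (rule dist_bound)
    fix t :: real
    define T where "T = max 0 t"
    have "G g t - G h t = exp (- (K * T)) *\<^sub>R integral {0..T} (\<lambda>s. H g s - H h s)"
      by (simp add: G_def T_def integral_diff integrable_continuous_real contH
          scaleR_diff_right)
    moreover have "norm \<dots> \<le> L * dist g h / K"
    proof (rule norm_weighted_integral_le)
      fix s
      have "norm (H g s - H h s) \<le> L * norm (exp (K * s) *\<^sub>R (apply_bcontfun g s - apply_bcontfun h s))"
        using lipschitz_on_normD[OF lip, of "x0 + exp (K * s) *\<^sub>R apply_bcontfun g s"
            "x0 + exp (K * s) *\<^sub>R apply_bcontfun h s"]
        by (simp add: H_def scaleR_diff_right)
      also have "\<dots> \<le> L * (exp (K * s) * dist g h)"
        using \<open>L \<ge> 0\<close> dist_bounded[of g s h] by (auto intro!: mult_left_mono simp: dist_norm)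
      finally show "norm (H g s - H h s) \<le> L * dist g h * exp (K * s)"
        by (simp add: algebra_simps)
    qed (use \<open>K > 0\<close> in \<open>auto simp: T_def intro!: continuous_intros contH\<close>)
    ultimately show "dist (apply_bcontfun (Bcontfun (G g)) t) (apply_bcontfun (Bcontfun (G h)) t)
        \<le> L / K * dist g h"
      by (simp add: G dist_norm)
  qed
  moreover have "0 \<le> L / K" "L / K < 1"
    using \<open>L \<ge> 0\<close> by (auto simp: K_def)
  ultimately obtain g where g: "Bcontfun (G g) = g"
    using banach_fix_type[of "L / K" "\<lambda>g. Bcontfun (G g)"] by blast
  \<comment> \<open>Undoing the weight turns the fixed point into a solution, as
    \<open>max 0 t = t\<close> for nonnegative times.\<close>
  define x where "x t = x0 + exp (K * t) *\<^sub>R apply_bcontfun g t" for t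
  show thesis
  proof
    show "continuous_on UNIV x"
      unfolding x_def by (intro continuous_intros continuous_on_apply_bcontfun)
    fix t :: real assume "t \<ge> 0"
    have "apply_bcontfun g t = G g t"
      using G[of g] unfolding g by (rule fun_cong)
    moreover have "H g = (\<lambda>s. F (x s))"
      by (simp add: H_def x_def fun_eq_iff)
    ultimately have "apply_bcontfun g t = exp (- (K * t)) *\<^sub>R integral {0..t} (\<lambda>s. F (x s))"
      using \<open>t \<ge> 0\<close> by (simp only: G_def max_absorb2)
    then show "x t = x0 + integral {0..t} (\<lambda>s. F (x s))"
      unfolding x_def[of t] by (simp add: exp_minus)
  qed
qed

text \<open>The integrand \<open>F (x s)\<close> is continuous, so the fundamental theorem of
  calculus differentiates the integral equation.\<close>

lemma lipschitz_ode_exists: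
  fixes F :: "'a::banach \<Rightarrow> 'a"
  assumes lip: "L-lipschitz_on UNIV F"
  obtains x :: "real \<Rightarrow> 'a" where "x 0 = x0"
    "\<And>t. t \<ge> 0 \<Longrightarrow> (x has_vector_derivative F (x t)) (at t within {0..})"
proof -
  obtain x :: "real \<Rightarrow> 'a" where contx: "continuous_on UNIV x"
    and x: "\<And>t. t \<ge> 0 \<Longrightarrow> x t = x0 + integral {0..t} (\<lambda>s. F (x s))"
    using lipschitz_integral_equation_exists[OF lip] by blast
  have contFx: "continuous_on S (\<lambda>s. F (x s))" for S
    using continuous_on_compose2[OF lipschitz_on_continuous_on[OF lip]
        continuous_on_subset[OF contx, of S]] by simp
  show thesis
  proof
    show "x 0 = x0" using x[of 0] by simp
    fix t :: real assume "t \<ge> 0"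
    then have "((\<lambda>u. x0 + integral {0..u} (\<lambda>s. F (x s))) has_vector_derivative F (x t))
        (at t within {0..t + 1})"
      by (auto intro!: derivative_eq_intros integral_has_vector_derivative contFx)
    then have "(x has_vector_derivative F (x t)) (at t within {0..t + 1})"
      by (rule has_vector_derivative_transform[rotated 2]) (use \<open>t \<ge> 0\<close> x in auto)
    moreover have "at t within {0..t + 1} = at t within {0..}"
      by (rule at_within_nhd[of _ "{..<t + 1}"]) auto
    ultimately show "(x has_vector_derivative F (x t)) (at t within {0..})"
      by simp
  qed
qed

text \<open>The squared distance, unlike the distance, is differentiable even where the solutions
  meet. By Cauchy-Schwarz its derivative is at most \<open>2 * L\<close> times itself, which the
  exponential factor offsets.\<close>

lemma lipschitz_ode_unique:
  fixes F :: "'a::real_inner \<Rightarrow> 'a"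
  assumes lip: "L-lipschitz_on UNIV F"
    and x: "\<And>t. t \<ge> 0 \<Longrightarrow> (x has_vector_derivative F (x t)) (at t within {0..})"
    and y: "\<And>t. t \<ge> 0 \<Longrightarrow> (y has_vector_derivative F (y t)) (at t within {0..})"
    and "x 0 = y 0" and "t \<ge> 0"
  shows "x t = y t"
proof -
  define z where "z t = y t - x t" for t
  define \<phi> where "\<phi> t = exp (- (2 * L * t)) * (z t \<bullet> z t)" for t
  define \<phi>' where "\<phi>' t = exp (- (2 * L * t)) * (2 * (z t \<bullet> (F (y t) - F (x t))) - 2 * L * (z t \<bullet> z t))" for t
  have deriv: "(\<phi> has_real_derivative \<phi>' t) (at t within {0..})" if "t \<ge> 0" for t
  proof -
    have "(z has_vector_derivative F (y t) - F (x t)) (at t within {0..})"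
      unfolding z_def using that by (intro has_vector_derivative_diff x y)
    then have "((\<lambda>t. z t \<bullet> z t) has_real_derivative 2 * (z t \<bullet> (F (y t) - F (x t)))) (at t within {0..})"
      unfolding has_vector_derivative_def has_field_derivative_def
      by (auto intro!: derivative_eq_intros ext simp: inner_commute algebra_simps)
    then show ?thesis
      unfolding \<phi>_def[abs_def] \<phi>'_def
      by (auto intro!: derivative_eq_intros simp: algebra_simps)
  qed
  have "\<phi>' t \<le> 0" for t
  proof -
    have "z t \<bullet> (F (y t) - F (x t)) \<le> norm (z t) * norm (F (y t) - F (x t))"
      by (rule norm_cauchy_schwarz)
    also have "\<dots> \<le> norm (z t) * (L * norm (z t))"
      unfolding z_def by (intro mult_left_mono lipschitz_on_normD[OF lip]) auto
    also have "\<dots> = L * (z t \<bullet> z t)"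
      by (simp add: power2_norm_eq_inner[symmetric] power2_eq_square)
    finally show ?thesis
      unfolding \<phi>'_def by (intro mult_nonneg_nonpos) auto
  qed
  have "\<phi> t \<le> \<phi> 0"
  \<comment> \<open>Two-sided derivatives exist at interior times only; continuity covers the
    endpoint 0.\<close>
  proof (rule DERIV_nonpos_imp_decreasing_open[OF \<open>t \<ge> 0\<close>])
    fix s :: real assume "0 < s"
    then have "at s within {0..} = at s"
      by (intro at_within_nhd[of s "{0<..}"]) auto
    then have "(\<phi> has_real_derivative \<phi>' s) (at s)"
      using deriv[of s] \<open>0 < s\<close> by simp
    then show "\<exists>d. (\<phi> has_real_derivative d) (at s) \<and> d \<le> 0"
      using \<open>\<phi>' s \<le> 0\<close> by blast
  next
    show "continuous_on {0..t} \<phi>"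
      by (rule DERIV_continuous_on, rule DERIV_subset, rule deriv) auto
  qed
  also have "\<phi> 0 = 0"
    using \<open>x 0 = y 0\<close> by (simp add: \<phi>_def z_def)
  finally have "z t \<bullet> z t \<le> 0"
    by (simp add: \<phi>_def mult_le_0_iff)
  then have "z t = 0"
    using inner_gt_zero_iff[of "z t"] by linarith
  then show ?thesis
    by (simp add: z_def)
qed

section \<open>The derived vector field is Lipschitz\<close>

text \<open>An index attaining the minimum at \<open>y\<close> bounds the minimum at
  \<open>x\<close> from above; exchanging the points gives the other inequality.\<close>

lemma lipschitz_on_Min:
  fixes f :: "'i \<Rightarrow> 'a::metric_space \<Rightarrow> real"
  assumes "finite I" "I \<noteq> {}" and lip: "\<And>i. i \<in> I \<Longrightarrow> L-lipschitz_on S (f i)"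
  shows "L-lipschitz_on S (\<lambda>x. Min ((\<lambda>i. f i x) ` I))"
proof (rule lipschitz_onI)
  have le: "Min ((\<lambda>i. f i x) ` I) \<le> Min ((\<lambda>i. f i y) ` I) + L * dist x y"
    if "x \<in> S" "y \<in> S" for x y
  proof -
    have "Min ((\<lambda>i. f i y) ` I) \<in> (\<lambda>i. f i y) ` I"
      using assms by (intro Min_in) auto
    then obtain i where i: "i \<in> I" "Min ((\<lambda>i. f i y) ` I) = f i y"
      by auto
    have "Min ((\<lambda>i. f i x) ` I) \<le> f i x"
      using assms i by (intro Min_le) auto
    also have "\<dots> \<le> f i y + L * dist x y"
      using lipschitz_onD[OF lip[OF i(1)] that] by (simp add: dist_real_def)
    finally show ?thesis using i by simp
  qed
  show "dist (Min ((\<lambda>i. f i x) ` I)) (Min ((\<lambda>i. f i y) ` I)) \<le> L * dist x y"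
    if "x \<in> S" "y \<in> S" for x y
    using le[OF that] le[OF that(2,1)] by (simp add: dist_real_def dist_commute abs_le_iff)
  show "0 \<le> L"
    using assms lipschitz_on_nonneg by blast
qed

lemma lipschitz_on_sum:
  fixes f :: "'i \<Rightarrow> 'a::metric_space \<Rightarrow> 'b::real_normed_vector"
  assumes "\<And>i. i \<in> I \<Longrightarrow> (C i)-lipschitz_on S (f i)"
  shows "(\<Sum>i\<in>I. C i)-lipschitz_on S (\<lambda>x. \<Sum>i\<in>I. f i x)"
  using assms
  \<comment> \<open>For infinite \<open>I\<close> both sums are 0 by convention, and a constant
    function is 0-Lipschitz.\<close>
  by (induction I rule: infinite_finite_induct) (auto intro: lipschitz_on_add lipschitz_on_constant)

lemma lipschitz_component_mult:
  fixes c :: real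
  shows "\<bar>c\<bar>-lipschitz_on S (\<lambda>x::real ^ 'd::finite. x $ P * c)"
proof -
  have "1-lipschitz_on S (\<lambda>x::real ^ 'd. x $ P)"
    by (rule lipschitz_onI) (auto simp: dist_vec_nth_le)
  then show ?thesis
    using lipschitz_on_cmult_real[of 1 S "\<lambda>x. x $ P" c] by (simp add: mult.commute)
qed

lemma lipschitz_rate_fun:
  fixes M :: "('d::finite, 'c, 'a) pepa"
  assumes "l \<in> activities M"
  shows "\<exists>L. L-lipschitz_on UNIV (\<lambda>x. rate_fun M x l)"
proof (cases l)
  case (Individual \<alpha> P Q)
  then show ?thesis
    using lipschitz_component_mult by auto
next
  case (Shared \<alpha> w)
  \<comment> \<open>A shared action is enabled somewhere, so the minimum ranges over a nonempty
    set.\<close>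
  then have "dom w \<noteq> {}"
    using assms by (auto simp: activities_def shared_def)
  let ?r = "\<lambda>P. \<bar>apparent_rate M \<alpha> P\<bar>"
  have "(Max (?r ` dom w))-lipschitz_on UNIV
      (\<lambda>x. Min ((\<lambda>P. x $ P * apparent_rate M \<alpha> P) ` dom w))"
    using \<open>dom w \<noteq> {}\<close>
    by (intro lipschitz_on_Min lipschitz_on_mono[OF lipschitz_component_mult]) auto
  \<comment> \<open>The product of rate ratios does not depend on the state, so it only scales the
    constant.\<close>
  from lipschitz_on_cmult_real[OF this] show ?thesis
    using Shared by auto
qed

text \<open>Each summand is a scalar Lipschitz function along a fixed vector, whose norm multiplies
  the constant; the constants then add up.\<close>

lemma lipschitz_derived_field:
  fixes M :: "('d::finite, 'c, 'a) pepa"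
  shows "\<exists>L. L-lipschitz_on UNIV (derived_field M)"
proof -
  obtain C where C: "\<And>l. l \<in> activities M \<Longrightarrow> (C l)-lipschitz_on UNIV (\<lambda>x. rate_fun M x l)"
    using lipschitz_rate_fun by metis
  have "(C l * norm (transition_vector l :: real ^ 'd))-lipschitz_on UNIV
      (\<lambda>x. rate_fun M x l *\<^sub>R transition_vector l)" if "l \<in> activities M" for l
  proof (rule lipschitz_onI)
    show "0 \<le> C l * norm (transition_vector l :: real ^ 'd)"
      using lipschitz_on_nonneg[OF C[OF that]] by simp
    show "dist (rate_fun M x l *\<^sub>R transition_vector l) (rate_fun M y l *\<^sub>R transition_vector l)
        \<le> C l * norm (transition_vector l :: real ^ 'd) * dist x y" for x y
      using mult_right_mono[OF lipschitz_onD[OF C[OF that], of x y]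
          norm_ge_zero[of "transition_vector l :: real ^ 'd"]]
      by (simp add: dist_norm flip: scaleR_diff_left) (simp add: algebra_simps)
  qed
  from lipschitz_on_sum[where I = "activities M", OF this] show ?thesis
    unfolding derived_field_def[abs_def] by (rule exI)
qed

theorem theorem1:
  fixes M :: "('d::finite, 'c, 'a) pepa" and x0 :: "real ^ 'd"
  assumes "pepa_model M"
  shows "\<exists>x. solves_derived_odes M x0 x \<and>
           (\<forall>y. solves_derived_odes M x0 y \<longrightarrow> (\<forall>t\<in>{0..}. y t = x t))"
proof -
  obtain L where lip: "L-lipschitz_on UNIV (derived_field M)"
    using lipschitz_derived_field by blast
  obtain x where x: "x 0 = x0"
    "\<And>t. t \<ge> 0 \<Longrightarrow> (x has_vector_derivative derived_field M (x t)) (at t within {0..})"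
    using lipschitz_ode_exists[OF lip] by blast
  then have "solves_derived_odes M x0 x"
    by (simp add: solves_derived_odes_def)
  \<comment> \<open>Solutions are total functions on \<open>real\<close> that the equations
    constrain only from time 0 on, so agreement is shown there.\<close>
  moreover have "y t = x t" if "solves_derived_odes M x0 y" "t \<ge> 0" for y t
    by (rule lipschitz_ode_unique[OF lip]) (use that x in \<open>auto simp: solves_derived_odes_def\<close>)
  ultimately show ?thesis
    by auto
qed

end
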